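(* Let $n\ge 2$, let $\Omega\subset\mathbb{R}^n$ be an open set and let $u\in BV(\Omega)$. For $\xi\in\mathbb{S}^{n-1}$ set $\Psi_\xi(u)=\int_\Omega|\sigma_u(x)\cdot\xi|\,d(|Du|)(x)$. Then $\mathcal{E}_\Omega(u)=0$ if and only if $\Psi_{\tilde\xi}(u)=0$ for some $\tilde\xi\in\mathbb{S}^{n-1}$.
   Context: $BV(\Omega)$ is the space of functions $u\in L^1(\Omega)$ of bounded variation (with finite total variation $|Du|(\Omega)$); $\sigma_u$ is the Radon-Nikodym derivative of $Du$ with respect to $|Du|$. The affine $BV$ energy of $u$ on $\Omega$ is $$\mathcal{E}_{\Omega}(u)=\alpha_n\left(\int_{\mathbb{S}^{n-1}}\left(\int_{\Omega}|\sigma_u(x)\cdot\xi|\,d(|Du|)(x)\right)^{-n}d\xi\right)^{-1/n},\qquad \alpha_n=(2\omega_{n-1})^{-1}(n\omega_n)^{1+1/n},$$ where $\omega_k$ is the volume of the unit ball in $\mathbb{R}^k$ and $d\xi$ is surface measure on the unit sphere $\mathbb{S}^{n-1}$; conventions: $0^{-n}=+\infty$, and the energy is $0$ if the outer integral is $+\infty$. *)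

theory Defs
  imports "HOL-Analysis.Analysis"
begin

text \<open>Vector measures on the measurable space underlying \<open>M\<close>; only \<open>space M\<close> and \<open>sets M\<close> matter.\<close>

definition vector_measure :: "'a measure \<Rightarrow> ('a set \<Rightarrow> 'b::euclidean_space) \<Rightarrow> bool" where
  "vector_measure M \<nu> \<longleftrightarrow>
     (\<forall>A :: nat \<Rightarrow> 'a set. range A \<subseteq> sets M \<longrightarrow> disjoint_family A \<longrightarrow>
        (\<lambda>i. \<nu> (A i)) sums \<nu> (\<Union>i. A i))"

definition variation :: "'a measure \<Rightarrow> ('a set \<Rightarrow> 'b::euclidean_space) \<Rightarrow> 'a set \<Rightarrow> ennreal" where
  "variation M \<nu> A =
     (SUP E \<in> {E :: nat \<Rightarrow> 'a set. range E \<subseteq> sets M \<and> disjoint_family E \<and> (\<Union>i. E i) = A}.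
        \<Sum>i. ennreal (norm (\<nu> (E i))))"

definition variation_measure :: "'a measure \<Rightarrow> ('a set \<Rightarrow> 'b::euclidean_space) \<Rightarrow> 'a measure" where
  "variation_measure M \<nu> = measure_of (space M) (sets M) (variation M \<nu>)"

text \<open>A version of the Radon--Nikodym derivative of \<open>\<nu>\<close> with respect to its variation; it is
  determined only up to null sets. The library's \<open>RN_deriv\<close> covers nonnegative measures only.\<close>

definition polar_density :: "'a measure \<Rightarrow> ('a set \<Rightarrow> 'b::euclidean_space) \<Rightarrow> 'a \<Rightarrow> 'b" where
  "polar_density M \<nu> = (SOME \<sigma>. integrable (variation_measure M \<nu>) \<sigma> \<and>
     (\<forall>A \<in> sets M. \<nu> A = set_lebesgue_integral (variation_measure M \<nu>) A \<sigma>))"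

definition vector_integral :: "'a measure \<Rightarrow> ('a set \<Rightarrow> 'b::euclidean_space) \<Rightarrow> ('a \<Rightarrow> 'b) \<Rightarrow> real" where
  "vector_integral M \<nu> \<phi> = (\<integral>x. \<phi> x \<bullet> polar_density M \<nu> x \<partial>variation_measure M \<nu>)"

definition C1c_field :: "(real^'n) set \<Rightarrow> (real^'n \<Rightarrow> real^'n) \<Rightarrow> bool" where
  "C1c_field \<Omega> \<phi> \<longleftrightarrow>
     (\<forall>x. \<phi> differentiable (at x)) \<and> continuous_on UNIV (\<lambda>x. jacobian \<phi> (at x)) \<and>
     (\<exists>K. compact K \<and> K \<subseteq> \<Omega> \<and> (\<forall>x. x \<notin> K \<longrightarrow> \<phi> x = 0))"

definition divergence :: "(real^'n \<Rightarrow> real^'n) \<Rightarrow> real^'n \<Rightarrow> real" where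
  "divergence \<phi> x = trace (jacobian \<phi> (at x))"

text \<open>\<open>\<nu>\<close> is a vector measure on \<open>\<Omega>\<close>, of finite total variation, which represents the
  distributional gradient of \<open>u\<close>.\<close>

definition gradient_measure :: "(real^'n) set \<Rightarrow> (real^'n \<Rightarrow> real) \<Rightarrow> ((real^'n) set \<Rightarrow> real^'n) \<Rightarrow> bool" where
  "gradient_measure \<Omega> u \<nu> \<longleftrightarrow>
     vector_measure (restrict_space borel \<Omega>) \<nu> \<and>
     variation (restrict_space borel \<Omega>) \<nu> \<Omega> < \<infinity> \<and>
     (\<forall>\<phi>. C1c_field \<Omega> \<phi> \<longrightarrow>
        set_lebesgue_integral lebesgue \<Omega> (\<lambda>x. u x * divergence \<phi> x) =
          - vector_integral (restrict_space borel \<Omega>) \<nu> \<phi>)"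

definition BV :: "(real^'n) set \<Rightarrow> (real^'n \<Rightarrow> real) set" where
  "BV \<Omega> = {u. set_integrable lebesgue \<Omega> u \<and> (\<exists>\<nu>. gradient_measure \<Omega> u \<nu>)}"

text \<open>\<open>Du\<close>, \<open>|Du|\<close> and \<open>\<sigma>\<^sub>u\<close> for \<open>u \<in> BV \<Omega>\<close>. The choice in the first one is harmless: the values
  on Borel subsets of \<open>\<Omega>\<close> are unique.\<close>

definition BV_deriv :: "(real^'n) set \<Rightarrow> (real^'n \<Rightarrow> real) \<Rightarrow> (real^'n) set \<Rightarrow> real^'n" where
  "BV_deriv \<Omega> u = (SOME \<nu>. gradient_measure \<Omega> u \<nu>)"

definition BV_variation :: "(real^'n) set \<Rightarrow> (real^'n \<Rightarrow> real) \<Rightarrow> (real^'n) measure" where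
  "BV_variation \<Omega> u = variation_measure (restrict_space borel \<Omega>) (BV_deriv \<Omega> u)"

definition BV_sigma :: "(real^'n) set \<Rightarrow> (real^'n \<Rightarrow> real) \<Rightarrow> real^'n \<Rightarrow> real^'n" where
  "BV_sigma \<Omega> u = polar_density (restrict_space borel \<Omega>) (BV_deriv \<Omega> u)"

text \<open>Surface measure on the unit sphere: \<open>n\<close> times the Lebesgue measure of the cone with
  vertex \<open>0\<close> over a set (see \<open>emeasure_sphere_measure\<close> below).\<close>

definition sphere_measure :: "(real^'n) measure" where
  "sphere_measure = scale_measure (of_nat CARD('n))
     (distr (restrict_space lborel (cball 0 1 - {0})) (restrict_space borel (sphere 0 1))
        (\<lambda>x. x /\<^sub>R norm x))"

lemma emeasure_sphere_measure:
  fixes A :: "(real^'n) set"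
  assumes "A \<in> sets borel" "A \<subseteq> sphere 0 1"
  shows "emeasure sphere_measure A =
    of_nat CARD('n) * emeasure lborel {r *\<^sub>R \<xi> | r \<xi>. 0 < r \<and> r \<le> 1 \<and> \<xi> \<in> A}"
proof -
  let ?B = "cball 0 1 - {0} :: (real^'n) set"
  let ?f = "\<lambda>x::real^'n. x /\<^sub>R norm x"
  have B: "?B \<in> sets borel" by measurable
  have f: "?f \<in> measurable (restrict_space lborel ?B) (restrict_space borel (sphere 0 1))"
    by (intro measurable_restrict_space2 measurable_restrict_space1)
       (auto simp: space_restrict_space)
  have A: "A \<in> sets (restrict_space borel (sphere 0 1))"
    using assms by (subst sets_restrict_space_iff) auto
  have eq: "?f -` A \<inter> space (restrict_space lborel ?B)
      = {r *\<^sub>R \<xi> | r \<xi>. 0 < r \<and> r \<le> 1 \<and> \<xi> \<in> A}" (is "?L = ?R")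
  proof (intro equalityI subsetI)
    fix x assume "x \<in> ?L"
    then have "x = norm x *\<^sub>R ?f x" "0 < norm x" "norm x \<le> 1" "?f x \<in> A"
      by (auto simp: space_restrict_space)
    then show "x \<in> ?R" by blast
  next
    fix x assume "x \<in> ?R"
    then obtain r \<xi> where x: "x = r *\<^sub>R \<xi>" "0 < r" "r \<le> 1" "\<xi> \<in> A" by auto
    then have "norm \<xi> = 1" using assms by auto
    then show "x \<in> ?L" using x by (auto simp: space_restrict_space)
  qed
  show ?thesis
    unfolding sphere_measure_def emeasure_scale_measure emeasure_distr[OF f A] eq
    using B eq by (subst emeasure_restrict_space) (auto simp: space_restrict_space)
qed

definition Psi :: "(real^'n) set \<Rightarrow> (real^'n \<Rightarrow> real) \<Rightarrow> real^'n \<Rightarrow> ennreal" where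
  "Psi \<Omega> u \<xi> = (\<integral>\<^sup>+x. ennreal \<bar>BV_sigma \<Omega> u x \<bullet> \<xi>\<bar> \<partial>BV_variation \<Omega> u)"

definition alpha :: "nat \<Rightarrow> real" where
  "alpha n = inverse (2 * unit_ball_vol (real n - 1)) *
     (real n * unit_ball_vol (real n)) powr (1 + 1 / real n)"

text \<open>In \<open>ennreal\<close>, \<open>inverse 0 = \<infinity>\<close>, which is the convention \<open>0\<^sup>-\<^sup>n = \<infinity>\<close>. The outer integral
  never vanishes for \<open>u \<in> BV \<Omega>\<close>, where \<open>Psi\<close> is bounded by \<open>|Du|(\<Omega>) < \<infinity>\<close>.\<close>

definition affine_energy :: "(real^'n) set \<Rightarrow> (real^'n \<Rightarrow> real) \<Rightarrow> real" where
  "affine_energy \<Omega> u =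
     (let I = \<integral>\<^sup>+\<xi>. inverse (Psi \<Omega> u \<xi> ^ CARD('n)) \<partial>sphere_measure
      in if I = \<infinity> then 0 else alpha CARD('n) * enn2real I powr (- 1 / real CARD('n)))"

end

theory Submission
  imports Defs
begin

text \<open>
  The function \<open>\<xi> \<mapsto> Psi \<Omega> u \<xi>\<close> is a seminorm, bounded by a multiple of \<open>norm \<xi>\<close>; hence it is
  Lipschitz (\<open>Psi_lipschitz\<close>), and the energy vanishes if and only if the integral of
  \<open>inverse (Psi \<Omega> u \<xi> ^ n)\<close> over the unit sphere diverges.

  If \<open>Psi \<Omega> u\<close> has a zero \<open>\<xi>\<close> on the sphere, then \<open>Psi \<Omega> u \<eta> \<le> L * norm (\<eta> - \<xi>)\<close>, and the
  integral diverges because the sphere has dimension \<open>n - 1 < n\<close>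
  (\<open>nn_integral_sphere_inverse_power_eq_infinity\<close>). The one geometric fact behind this is a lower
  bound for the measure of a cap (\<open>emeasure_sphere_cap_ge\<close>), which is read off from disjoint balls
  inside the cone over the cap. If \<open>Psi \<Omega> u\<close> has no zero there, then it lies between two positive
  constants on the sphere, by compactness and by the Lipschitz bound, so the integral is positive and
  finite, and so is the energy.

  The finiteness of \<open>Psi\<close> rests on measure theory: the variation of a vector measure, when finite, is
  a measure (\<open>variation_countably_additive\<close>), and the polar density with respect to it exists and is
  integrable (\<open>integrable_polar_density\<close>).
\<close>

section \<open>The variation of a vector measure\<close>

lemma vector_measureD:
  assumes "vector_measure M \<nu>" "range A \<subseteq> sets M" "disjoint_family A"
  shows "(\<lambda>i::nat. \<nu> (A i)) sums \<nu> (\<Union>i. A i)"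
  using assms by (auto simp: vector_measure_def)

text \<open>A series with constant terms converges only if the terms vanish.\<close>

lemma vector_measure_empty:
  assumes "vector_measure M \<nu>"
  shows "\<nu> {} = 0"
proof -
  have "(\<lambda>i::nat. \<nu> {}) sums \<nu> (\<Union>i::nat. {})"
    by (rule vector_measureD[OF assms]) (auto simp: disjoint_family_on_def)
  then have "summable (\<lambda>i::nat. \<nu> {})" by (rule sums_summable)
  then have "(\<lambda>i::nat. \<nu> {}) \<longlonglongrightarrow> 0" by (rule summable_LIMSEQ_zero)
  then show ?thesis by (simp add: LIMSEQ_const_iff)
qed

text \<open>The triangle inequality for series that may converge only conditionally; the right-hand side
  is then infinite.\<close>

lemma norm_le_suminf_ennreal_norm:
  fixes f :: "nat \<Rightarrow> 'b::banach"
  assumes "f sums s"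
  shows "ennreal (norm s) \<le> (\<Sum>i. ennreal (norm (f i)))"
proof (cases "summable (\<lambda>i. norm (f i))")
  case True
  have "norm s \<le> (\<Sum>i. norm (f i))"
    using summable_norm[OF True] assms by (simp add: sums_iff)
  moreover have "(\<Sum>i. ennreal (norm (f i))) = ennreal (\<Sum>i. norm (f i))"
    by (rule suminf_ennreal2[OF norm_ge_zero True])
  ultimately show ?thesis by (simp only: ennreal_leI)
next
  case False
  then have "(\<Sum>i. ennreal (norm (f i))) = top"
    by (rule contrapos_np) (rule summable_suminf_not_top[OF norm_ge_zero])
  then show ?thesis by simp
qed

lemma variation_upper:
  assumes "range E \<subseteq> sets M" "disjoint_family E" "(\<Union>i. E i) = A"
  shows "(\<Sum>i::nat. ennreal (norm (\<nu> (E i)))) \<le> variation M \<nu> A"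
  unfolding variation_def using assms by (intro SUP_upper CollectI conjI)

lemma variation_least:
  assumes "\<And>E :: nat \<Rightarrow> 'a set. \<lbrakk>range E \<subseteq> sets M; disjoint_family E; (\<Union>i. E i) = A\<rbrakk>
    \<Longrightarrow> (\<Sum>i. ennreal (norm (\<nu> (E i)))) \<le> c"
  shows "variation M \<nu> A \<le> c"
  unfolding variation_def by (rule SUP_least) (elim CollectE conjE, rule assms)

lemma variation_empty:
  assumes "vector_measure M \<nu>"
  shows "variation M \<nu> {} = 0"
proof -
  have "variation M \<nu> {} \<le> 0"
  proof (rule variation_least)
    fix E :: "nat \<Rightarrow> 'a set" assume "(\<Union>i. E i) = {}"
    then have "E i = {}" for i by blast
    then show "(\<Sum>i. ennreal (norm (\<nu> (E i)))) \<le> 0"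
      by (simp add: vector_measure_empty[OF assms])
  qed
  then show ?thesis by simp
qed

lemma norm_le_variation:
  assumes "vector_measure M \<nu>" "A \<in> sets M"
  shows "ennreal (norm (\<nu> A)) \<le> variation M \<nu> A"
proof -
  have "(\<Sum>i::nat. ennreal (norm (\<nu> (if i = 0 then A else {})))) \<le> variation M \<nu> A"
    by (rule variation_upper) (use assms in \<open>auto simp: disjoint_family_on_def split: if_splits\<close>)
  moreover have "(\<Sum>i::nat. ennreal (norm (\<nu> (if i = 0 then A else {}))))
      = ennreal (norm (\<nu> A))"
    using vector_measure_empty[OF assms(1)] by (subst suminf_finite[of "{0}"]) auto
  ultimately show ?thesis by simp
qed

text \<open>A partition of \<open>A\<close> becomes one of \<open>B\<close> when \<open>B - A\<close> is put in front of it.\<close>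

lemma variation_mono:
  assumes "A \<in> sets M" "B \<in> sets M" "A \<subseteq> B"
  shows "variation M \<nu> A \<le> variation M \<nu> B"
proof (rule variation_least)
  fix E :: "nat \<Rightarrow> 'a set"
  assume E: "range E \<subseteq> sets M" "disjoint_family E" "(\<Union>i. E i) = A"
  define F where "F i = (case i of 0 \<Rightarrow> B - A | Suc j \<Rightarrow> E j)" for i
  have "F i \<in> sets M" for i using E(1) assms by (cases i) (auto simp: F_def)
  then have "range F \<subseteq> sets M" by blast
  moreover have "disjoint_family F"
    unfolding disjoint_family_on_def
  proof (intro ballI impI)
    fix i j :: nat assume "i \<noteq> j"
    then show "F i \<inter> F j = {}"
      using E(2,3) by (cases i; cases j) (auto simp: F_def disjoint_family_on_def)
  qed
  moreover have "(\<Union>i. F i) = B"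
  proof -
    have "F 0 = B - A" "\<And>j. F (Suc j) = E j" by (simp_all add: F_def)
    moreover have "(\<Union>i. F i) = F 0 \<union> (\<Union>i. F (Suc i))"
      by (subst UNIV_nat_eq) (simp only: UN_insert image_image)
    ultimately show ?thesis using E(3) assms(3) by auto
  qed
  ultimately have le: "(\<Sum>i. ennreal (norm (\<nu> (F i)))) \<le> variation M \<nu> B"
    by (rule variation_upper)
  have "(\<Sum>i. ennreal (norm (\<nu> (E i)))) = (\<Sum>i. ennreal (norm (\<nu> (F (i + 1)))))"
    by (simp add: F_def)
  also have "\<dots> \<le> (\<Sum>i. ennreal (norm (\<nu> (F i))))"
    by (subst suminf_offset[of "\<lambda>i. ennreal (norm (\<nu> (F i)))" 1]) (simp_all only: summableI le_iff_add, blast)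
  finally show "(\<Sum>i. ennreal (norm (\<nu> (E i)))) \<le> variation M \<nu> B" using le by simp
qed

text \<open>For countable subadditivity a partition of the union is refined by the given sets. For the
  converse, near-optimal partitions of the single sets are merged into one partition of the union;
  finiteness makes near-optimal partitions available.\<close>

lemma variation_countably_additive:
  fixes \<nu> :: "'a set \<Rightarrow> 'b::euclidean_space"
  assumes \<nu>: "vector_measure M \<nu>" and fin: "variation M \<nu> (space M) < \<infinity>"
  shows "countably_additive (sets M) (variation M \<nu>)"
  unfolding countably_additive_def
proof (intro allI impI antisym)
  fix A :: "nat \<Rightarrow> 'a set"
  assume A: "range A \<subseteq> sets M" "disjoint_family A"
  show "variation M \<nu> (\<Union>i. A i) \<le> (\<Sum>i. variation M \<nu> (A i))"
  proof (rule variation_least)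
    fix E :: "nat \<Rightarrow> 'a set"
    assume E: "range E \<subseteq> sets M" "disjoint_family E" "(\<Union>i. E i) = (\<Union>i. A i)"
    have "(\<Sum>j. ennreal (norm (\<nu> (E j)))) \<le> (\<Sum>j. \<Sum>i. ennreal (norm (\<nu> (E j \<inter> A i))))"
    proof (intro suminf_le allI)
      fix j
      have "disjoint_family (\<lambda>i. E j \<inter> A i)"
        using A(2) unfolding disjoint_family_on_def by blast
      then have "(\<lambda>i. \<nu> (E j \<inter> A i)) sums \<nu> (\<Union>i. E j \<inter> A i)"
        by (intro vector_measureD[OF \<nu>]) (use A(1) E(1) in blast)+
      moreover have "(\<Union>i. E j \<inter> A i) = E j" using E(3) by blast
      ultimately show "ennreal (norm (\<nu> (E j))) \<le> (\<Sum>i. ennreal (norm (\<nu> (E j \<inter> A i))))"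
        using norm_le_suminf_ennreal_norm by metis
    qed auto
    also have "\<dots> = (\<Sum>i. \<Sum>j. ennreal (norm (\<nu> (E j \<inter> A i))))"
      unfolding nn_integral_count_space_nat[symmetric, of "\<lambda>j. \<Sum>i. ennreal (norm (\<nu> (E j \<inter> A i)))"]
      by (subst nn_integral_suminf) (simp_all add: nn_integral_count_space_nat)
    also have "\<dots> \<le> (\<Sum>i. variation M \<nu> (A i))"
    proof (intro suminf_le allI variation_upper)
      fix i
      show "disjoint_family (\<lambda>j. E j \<inter> A i)"
        using E(2) unfolding disjoint_family_on_def by blast
      show "range (\<lambda>j. E j \<inter> A i) \<subseteq> sets M" using A(1) E(1) by blast
      show "(\<Union>j. E j \<inter> A i) = A i" using E(3) by blast
    qed auto
    finally show "(\<Sum>j. ennreal (norm (\<nu> (E j)))) \<le> (\<Sum>i. variation M \<nu> (A i))" .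
  qed
  show "(\<Sum>i. variation M \<nu> (A i)) \<le> variation M \<nu> (\<Union>i. A i)"
  proof (rule ennreal_le_epsilon)
    fix e :: real assume e: "0 < e"
    define near where "near i E \<longleftrightarrow> range E \<subseteq> sets M \<and> disjoint_family E \<and> (\<Union>j. E j) = A i \<and>
        variation M \<nu> (A i) \<le> (\<Sum>j. ennreal (norm (\<nu> (E j)))) + ennreal (e * (1/2) ^ Suc i)"
      for i and E :: "nat \<Rightarrow> 'a set"
    have "\<exists>E. near i E" for i
    proof -
      let ?\<E> = "{E :: nat \<Rightarrow> 'a set. range E \<subseteq> sets M \<and> disjoint_family E \<and> (\<Union>j. E j) = A i}"
      have Ai: "A i \<in> sets M" using A(1) by blast
      then have "variation M \<nu> (A i) \<le> variation M \<nu> (space M)"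
        by (intro variation_mono) (auto dest: sets.sets_into_space)
      with fin have ne: "variation M \<nu> (A i) \<noteq> \<infinity>" by auto
      have "(\<lambda>j. if j = 0 then A i else {}) \<in> ?\<E>"
        using Ai by (auto simp: disjoint_family_on_def split: if_splits)
      then have "?\<E> \<noteq> {}" by blast
      have "0 < e * (1/2) ^ Suc i" using e by simp
      then obtain E where E: "E \<in> ?\<E>"
          "variation M \<nu> (A i) < (\<Sum>j. ennreal (norm (\<nu> (E j)))) + ennreal (e * (1/2) ^ Suc i)"
        by (rule bexE[OF SUP_approx_ennreal[OF _ \<open>?\<E> \<noteq> {}\<close> variation_def[of M \<nu> "A i"] ne]])
      then have "near i E"
        unfolding near_def using less_imp_le[OF E(2)] by (intro conjI) (elim CollectE conjE, assumption)+
      then show ?thesis by (rule exI[of "near i"])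
    qed
    then obtain E where near: "\<And>i. near i (E i)" by metis
    have E: "range (E i) \<subseteq> sets M" "disjoint_family (E i)" "(\<Union>j. E i j) = A i"
        "variation M \<nu> (A i)
          \<le> (\<Sum>j. ennreal (norm (\<nu> (E i j)))) + ennreal (e * (1/2) ^ Suc i)" for i
      using near[of i] unfolding near_def by - (elim conjE, assumption)+
    \<comment> \<open>one sequence that runs through the whole double sequence \<open>E\<close>\<close>
    define F where "F k = (case prod_decode k of (i, j) \<Rightarrow> E i j)" for k
    have "(\<Sum>i. variation M \<nu> (A i))
        \<le> (\<Sum>i. (\<Sum>j. ennreal (norm (\<nu> (E i j)))) + ennreal (e * (1/2) ^ Suc i))"
      by (intro suminf_le E(4)) auto
    also have "\<dots> = (\<Sum>i. \<Sum>j. ennreal (norm (\<nu> (E i j)))) + (\<Sum>i. ennreal (e * (1/2) ^ Suc i))"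
      by (rule suminf_add[symmetric]) auto
    also have "(\<Sum>i. ennreal (e * (1/2) ^ Suc i)) = ennreal e"
      using e sums_mult[OF power_half_series, of e] by (intro suminf_ennreal_eq) auto
    also have "(\<Sum>i. \<Sum>j. ennreal (norm (\<nu> (E i j)))) = (\<Sum>k. ennreal (norm (\<nu> (F k))))"
      unfolding F_def split_beta
      by (rule suminf_ennreal_2dimen[where f = "\<lambda>p. ennreal (norm (\<nu> (E (fst p) (snd p))))", symmetric])
        (simp only: fst_conv snd_conv)
    also have "(\<Sum>k. ennreal (norm (\<nu> (F k)))) \<le> variation M \<nu> (\<Union>i. A i)"
    proof (rule variation_upper)
      have F: "F k = E (fst (prod_decode k)) (snd (prod_decode k))" for k
        by (simp add: F_def split_beta)
      show "range F \<subseteq> sets M" unfolding F using E(1) by blast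
      have "F (prod_encode (i, j)) = E i j" for i j by (simp add: F_def)
      then have "E i j \<subseteq> (\<Union>k. F k)" for i j by (metis UN_upper UNIV_I)
      moreover have "F k \<subseteq> (\<Union>i. \<Union>j. E i j)" for k unfolding F by blast
      ultimately have "(\<Union>k. F k) = (\<Union>i. \<Union>j. E i j)"
        by (intro equalityI UN_least)
      then show "(\<Union>k. F k) = (\<Union>i. A i)" by (simp only: E(3))
      have sub: "E i j \<subseteq> A i" for i j using E(3)[of i] by blast
      show "disjoint_family F"
        unfolding disjoint_family_on_def
      proof (intro ballI impI)
        fix k l :: nat assume "k \<noteq> l"
        obtain i j where di: "prod_decode k = (i, j)" by (rule prod.exhaust)
        obtain i' j' where dl: "prod_decode l = (i', j')" by (rule prod.exhaust)
        note d = di dl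
        have "(i, j) \<noteq> (i', j')"
          using \<open>k \<noteq> l\<close> d by (metis prod_decode_inverse)
        have "E i j \<inter> E i' j' = {}"
        proof (cases "i = i'")
          case True
          with \<open>(i, j) \<noteq> (i', j')\<close> have "j \<noteq> j'" by simp
          with True show ?thesis using disjoint_family_onD[OF E(2)[of i], of j j'] by simp
        next
          case False
          then have "A i \<inter> A i' = {}" using disjoint_family_onD[OF A(2), of i i'] by simp
          then show ?thesis using sub[of i j] sub[of i' j'] by blast
        qed
        then show "F k \<inter> F l = {}" by (simp add: F_def d)
      qed
    qed
    finally show "(\<Sum>i. variation M \<nu> (A i)) \<le> variation M \<nu> (\<Union>i. A i) + ennreal e"
      by (simp only: add_right_mono)
  qed
qed

lemma space_variation_measure [simp]: "space (variation_measure M \<nu>) = space M"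
  and sets_variation_measure [simp]: "sets (variation_measure M \<nu>) = sets M"
  by (simp_all add: variation_measure_def)

lemma emeasure_variation_measure:
  assumes "vector_measure M \<nu>" "variation M \<nu> (space M) < \<infinity>" "A \<in> sets M"
  shows "emeasure (variation_measure M \<nu>) A = variation M \<nu> A"
  unfolding variation_measure_def
  by (rule emeasure_measure_of_sigma)
     (use assms variation_countably_additive[OF assms(1,2)] in
       \<open>auto simp: positive_def variation_empty sets.sigma_algebra_axioms\<close>)

section \<open>The polar density\<close>

text \<open>A signed measure dominated by \<open>V\<close> becomes nonnegative when \<open>V\<close> is added to it, so that the
  Radon--Nikodym theorem for nonnegative measures applies; the density of \<open>V\<close> itself, which is
  \<open>1\<close>, is subtracted afterwards.\<close>

lemma dominated_signed_measure_density:
  fixes \<nu> :: "'a set \<Rightarrow> real"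
  assumes V: "finite_measure V"
    and sums: "\<And>A :: nat \<Rightarrow> 'a set. \<lbrakk>range A \<subseteq> sets V; disjoint_family A\<rbrakk>
      \<Longrightarrow> (\<lambda>i. \<nu> (A i)) sums \<nu> (\<Union>i. A i)"
    and dom: "\<And>A. A \<in> sets V \<Longrightarrow> \<bar>\<nu> A\<bar> \<le> measure V A"
  shows "\<exists>g. integrable V g \<and> (\<forall>A\<in>sets V. \<nu> A = set_lebesgue_integral V A g)"
proof -
  interpret V: finite_measure V by fact
  define N where "N = measure_of (space V) (sets V) (\<lambda>A. ennreal (\<nu> A + measure V A))"
  have sN[measurable_cong, simp]: "sets N = sets V" and spN [simp]: "space N = space V"
    by (simp_all add: N_def)
  have nn: "0 \<le> \<nu> A + measure V A" if "A \<in> sets V" for A using dom[OF that] by auto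
  have eN: "emeasure N A = ennreal (\<nu> A + measure V A)" if "A \<in> sets V" for A
    unfolding N_def
  proof (rule emeasure_measure_of_sigma)
    show "positive (sets V) (\<lambda>A. ennreal (\<nu> A + measure V A))"
      using dom[of "{}"] by (simp add: positive_def)
    show "countably_additive (sets V) (\<lambda>A. ennreal (\<nu> A + measure V A))"
      unfolding countably_additive_def
    proof (intro allI impI)
      fix A :: "nat \<Rightarrow> 'a set" assume A: "range A \<subseteq> sets V" "disjoint_family A"
      have "(\<lambda>i. \<nu> (A i) + measure V (A i)) sums (\<nu> (\<Union>i. A i) + measure V (\<Union>i. A i))"
        by (intro sums_add sums A V.finite_measure_UNION)
      then show "(\<Sum>i. ennreal (\<nu> (A i) + measure V (A i)))
          = ennreal (\<nu> (\<Union>i. A i) + measure V (\<Union>i. A i))"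
        by (intro suminf_ennreal_eq nn) (use A(1) in blast)+
    qed
  qed (use that in \<open>auto simp: sets.sigma_algebra_axioms\<close>)
  have finN: "finite_measure N"
    by (rule finite_measureI) (simp add: eN)
  have ac: "absolutely_continuous V N"
  proof -
    have "emeasure N A = 0" if A: "A \<in> sets V" "emeasure V A = 0" for A
    proof -
      have "measure V A = 0" using A by (simp add: measure_def)
      with dom[OF A(1)] have "\<nu> A + measure V A = 0" by auto
      then show ?thesis using eN[OF A(1)] by simp
    qed
    then show ?thesis by (auto simp: absolutely_continuous_def null_sets_def)
  qed
  obtain D where D: "D \<in> borel_measurable V" "AE x in V. RN_deriv V N x = ennreal (D x)"
      "\<And>x. 0 \<le> D x"
    using V.real_RN_deriv[OF finN ac sN] by blast
  have dens: "emeasure N A = (\<integral>\<^sup>+x. ennreal (D x * indicator A x) \<partial>V)" if A: "A \<in> sets V" for A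
  proof -
    have "emeasure N A = emeasure (density V (RN_deriv V N)) A"
      by (simp add: V.density_RN_deriv[OF ac sN])
    also have "\<dots> = (\<integral>\<^sup>+x. RN_deriv V N x * indicator A x \<partial>V)"
      using A by (intro emeasure_density) auto
    also have "\<dots> = (\<integral>\<^sup>+x. ennreal (D x * indicator A x) \<partial>V)"
      by (rule nn_integral_cong_AE)
         (use D(2) in eventually_elim, auto simp: ennreal_indicator indicator_def)
    finally show ?thesis .
  qed
  have bi: "has_bochner_integral V (\<lambda>x. D x * indicator A x) (\<nu> A + measure V A)"
    if A: "A \<in> sets V" for A
    by (rule has_bochner_integral_nn_integral)
       (use A D(1,3) nn[OF A] dens[OF A] eN[OF A] in \<open>auto intro!: borel_measurable_times\<close>)
  have "integrable V D"
  proof -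
    have "integrable V (\<lambda>x. D x * indicator (space V) x)"
      using bi[of "space V"] by (auto simp: has_bochner_integral_iff)
    also have "?this \<longleftrightarrow> integrable V D" by (rule Bochner_Integration.integrable_cong) auto
    finally show ?thesis .
  qed
  moreover have "\<nu> A = set_lebesgue_integral V A (\<lambda>x. D x - 1)" if A: "A \<in> sets V" for A
  proof -
    have "set_lebesgue_integral V A (\<lambda>x. D x - 1)
        = (\<integral>x. D x * indicator A x - indicator A x \<partial>V)"
      unfolding set_lebesgue_integral_def
      by (intro Bochner_Integration.integral_cong) (auto simp: indicator_def)
    also have "\<dots> = (\<integral>x. D x * indicator A x \<partial>V) - (\<integral>x. indicator A x \<partial>V)"
      using bi[OF A] A
      by (intro Bochner_Integration.integral_diff)
         (auto simp: has_bochner_integral_iff less_top[symmetric])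
    also have "\<dots> = \<nu> A"
      using bi[OF A] A by (simp add: has_bochner_integral_iff)
    finally show ?thesis by simp
  qed
  ultimately show ?thesis by (intro exI[of _ "\<lambda>x. D x - 1"]) auto
qed

text \<open>The definition of \<open>polar_density\<close> chooses a density, so all depends on the existence of one. It
  is found coordinate by coordinate: each coordinate of \<open>\<nu>\<close> is a signed measure dominated by the
  variation.\<close>

lemma integrable_polar_density:
  fixes \<nu> :: "'a set \<Rightarrow> 'b::euclidean_space"
  assumes \<nu>: "vector_measure M \<nu>" and fin: "variation M \<nu> (space M) < \<infinity>"
  shows "integrable (variation_measure M \<nu>) (polar_density M \<nu>)"
proof -
  let ?V = "variation_measure M \<nu>"
  note eV = emeasure_variation_measure[OF \<nu> fin]
  interpret V: finite_measure ?V
    by (rule finite_measureI) (use fin eV in auto)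
  have dom: "norm (\<nu> A) \<le> measure ?V A" if "A \<in> sets M" for A
  proof -
    have "ennreal (norm (\<nu> A)) \<le> ennreal (measure ?V A)"
      using norm_le_variation[OF \<nu> that] eV[OF that] V.emeasure_eq_measure[of A] by simp
    then show ?thesis by simp
  qed
  have "\<exists>g. integrable ?V g \<and> (\<forall>A\<in>sets ?V. \<nu> A \<bullet> b = set_lebesgue_integral ?V A g)"
    if b: "b \<in> Basis" for b
  proof (rule dominated_signed_measure_density)
    fix A :: "nat \<Rightarrow> 'a set" assume "range A \<subseteq> sets ?V" "disjoint_family A"
    then show "(\<lambda>i. \<nu> (A i) \<bullet> b) sums (\<nu> (\<Union>i. A i) \<bullet> b)"
      by (intro bounded_linear.sums[OF bounded_linear_inner_left] vector_measureD[OF \<nu>]) auto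
  next
    fix A assume "A \<in> sets ?V"
    then show "\<bar>\<nu> A \<bullet> b\<bar> \<le> measure ?V A"
      using dom[of A] Basis_le_norm[OF b, of "\<nu> A"] by simp
  qed (rule V.finite_measure_axioms)
  then obtain g where g: "\<And>b. b \<in> Basis \<Longrightarrow> integrable ?V (g b)"
      "\<And>b A. b \<in> Basis \<Longrightarrow> A \<in> sets M \<Longrightarrow> \<nu> A \<bullet> b = set_lebesgue_integral ?V A (g b)"
    by (simp, metis)
  define \<sigma> where "\<sigma> x = (\<Sum>b\<in>Basis. g b x *\<^sub>R b)" for x
  have "integrable ?V \<sigma>"
    unfolding \<sigma>_def
    by (intro Bochner_Integration.integrable_sum integrable_scaleR_left g)
  moreover have "\<nu> A = set_lebesgue_integral ?V A \<sigma>" if A: "A \<in> sets M" for A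
  proof (rule euclidean_eqI)
    fix b :: 'b assume b: "b \<in> Basis"
    have "set_integrable ?V A \<sigma>"
      using \<open>integrable ?V \<sigma>\<close> A by (auto simp: set_integrable_def intro: integrable_mult_indicator)
    then have "set_lebesgue_integral ?V A \<sigma> \<bullet> b = (\<integral>x. (indicator A x *\<^sub>R \<sigma> x) \<bullet> b \<partial>?V)"
      unfolding set_lebesgue_integral_def set_integrable_def
      by (intro Bochner_Integration.integral_inner_left[symmetric]) simp
    also have "\<dots> = set_lebesgue_integral ?V A (g b)"
      unfolding set_lebesgue_integral_def
      using b by (intro Bochner_Integration.integral_cong)
        (auto simp: \<sigma>_def inner_sum_left inner_Basis if_distrib sum.If_cases cong: if_cong)
    finally show "\<nu> A \<bullet> b = set_lebesgue_integral ?V A \<sigma> \<bullet> b" using g(2)[OF b A] by simp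
  qed
  ultimately have "\<exists>\<sigma>. integrable ?V \<sigma> \<and>
      (\<forall>A\<in>sets M. \<nu> A = set_lebesgue_integral ?V A \<sigma>)" by blast
  from someI_ex[OF this] show ?thesis unfolding polar_density_def by (rule conjunct1)
qed

lemma integrable_BV_sigma:
  assumes "u \<in> BV \<Omega>"
  shows "integrable (BV_variation \<Omega> u) (BV_sigma \<Omega> u)"
proof -
  have "\<exists>\<nu>. gradient_measure \<Omega> u \<nu>"
    using assms unfolding BV_def by blast
  then have "gradient_measure \<Omega> u (BV_deriv \<Omega> u)"
    unfolding BV_deriv_def by (rule someI_ex)
  then have "vector_measure (restrict_space borel \<Omega>) (BV_deriv \<Omega> u)"
      "variation (restrict_space borel \<Omega>) (BV_deriv \<Omega> u) \<Omega> < \<infinity>"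
    unfolding gradient_measure_def by blast+
  then show ?thesis
    unfolding BV_variation_def BV_sigma_def
    by (intro integrable_polar_density) (simp_all add: space_restrict_space)
qed

section \<open>The directional variation as a function of the direction\<close>

text \<open>By the Cauchy--Schwarz inequality, the integral of \<open>norm \<circ> \<sigma>\<^sub>u\<close> is a Lipschitz constant. It is
  increased by \<open>1\<close> to be positive also when \<open>Du = 0\<close>. The bound is stated additively, in \<open>ennreal\<close>;
  with \<open>\<eta> = 0\<close> it says that \<open>Psi\<close> is finite.\<close>

lemma Psi_lipschitz:
  assumes u: "u \<in> BV \<Omega>"
  obtains L where "L > 0" and "\<And>\<xi> \<eta>. Psi \<Omega> u \<xi> \<le> Psi \<Omega> u \<eta> + ennreal (L * norm (\<xi> - \<eta>))"
proof -
  let ?V = "BV_variation \<Omega> u" and ?\<sigma> = "BV_sigma \<Omega> u"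
  note int = integrable_BV_sigma[OF u]
  note [measurable] = borel_measurable_integrable[OF int]
  define L where "L = (\<integral>x. norm (?\<sigma> x) \<partial>?V)"
  have L: "(\<integral>\<^sup>+x. ennreal (norm (?\<sigma> x)) \<partial>?V) = ennreal L" "L \<ge> 0"
    unfolding L_def using int by (auto intro!: nn_integral_eq_integral integral_nonneg)
  have "Psi \<Omega> u \<xi> \<le> Psi \<Omega> u \<eta> + ennreal ((L + 1) * norm (\<xi> - \<eta>))" for \<xi> \<eta>
  proof -
    have "\<bar>s \<bullet> \<xi>\<bar> \<le> \<bar>s \<bullet> \<eta>\<bar> + norm s * norm (\<xi> - \<eta>)" for s
    proof -
      have "\<bar>s \<bullet> (\<xi> - \<eta>)\<bar> \<le> norm s * norm (\<xi> - \<eta>)" by (rule Cauchy_Schwarz_ineq2)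
      then show ?thesis by (simp add: inner_diff_right)
    qed
    then have "Psi \<Omega> u \<xi> \<le> (\<integral>\<^sup>+x. ennreal \<bar>?\<sigma> x \<bullet> \<eta>\<bar>
        + ennreal (norm (?\<sigma> x)) * ennreal (norm (\<xi> - \<eta>)) \<partial>?V)"
      unfolding Psi_def
      by (intro nn_integral_mono) (simp add: ennreal_mult'[symmetric] flip: ennreal_plus)
    also have "\<dots> = Psi \<Omega> u \<eta> + ennreal L * ennreal (norm (\<xi> - \<eta>))"
      by (subst nn_integral_add) (auto simp: Psi_def nn_integral_multc L)
    also have "\<dots> \<le> Psi \<Omega> u \<eta> + ennreal ((L + 1) * norm (\<xi> - \<eta>))"
      using L(2) by (auto simp: ennreal_mult'[symmetric] intro!: add_left_mono ennreal_leI mult_right_mono)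
    finally show ?thesis .
  qed
  with L(2) show thesis by (intro that[of "L + 1"]) auto
qed

lemma Psi_zero: "Psi \<Omega> u 0 = 0"
  by (simp add: Psi_def)

text \<open>A direction of minimal directional variation exists by compactness of the sphere.\<close>

lemma Psi_bounded_below:
  fixes \<Omega> :: "(real^'n) set"
  assumes u: "u \<in> BV \<Omega>" and pos: "\<And>\<xi>. \<xi> \<in> sphere 0 1 \<Longrightarrow> Psi \<Omega> u \<xi> \<noteq> 0"
  obtains c where "c > 0" and "\<And>\<xi>. \<xi> \<in> sphere 0 1 \<Longrightarrow> ennreal c \<le> Psi \<Omega> u \<xi>"
proof -
  obtain L where L: "L > 0" "\<And>\<xi> \<eta>. Psi \<Omega> u \<xi> \<le> Psi \<Omega> u \<eta> + ennreal (L * norm (\<xi> - \<eta>))"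
    using Psi_lipschitz[OF u] by metis
  \<comment> \<open>\<open>Psi\<close> is finite, so it can be treated as a real function\<close>
  define p where "p \<xi> = enn2real (Psi \<Omega> u \<xi>)" for \<xi>
  have "Psi \<Omega> u \<xi> < \<infinity>" for \<xi>
    using L(2)[of \<xi> 0] by (simp add: Psi_zero le_less_trans)
  then have p: "Psi \<Omega> u \<xi> = ennreal (p \<xi>)" "0 \<le> p \<xi>" for \<xi>
    by (simp_all add: p_def)
  have le: "p \<xi> \<le> p \<eta> + L * norm (\<xi> - \<eta>)" for \<xi> \<eta>
    using L(2)[of \<xi> \<eta>] L(1) p(2)[of \<eta>] by (simp add: p flip: ennreal_plus)
  have "L-lipschitz_on UNIV p"
  proof (rule lipschitz_onI)
    fix \<xi> \<eta>
    show "dist (p \<xi>) (p \<eta>) \<le> L * dist \<xi> \<eta>"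
      using le[of \<xi> \<eta>] le[of \<eta> \<xi>] by (simp add: dist_norm abs_le_iff norm_minus_commute)
  qed (use L in auto)
  then have "continuous_on (sphere 0 1) p"
    by (auto intro: lipschitz_on_continuous_on continuous_on_subset)
  moreover have "sphere 0 1 \<noteq> ({} :: (real^'n) set)" by simp
  ultimately obtain \<xi> where \<xi>: "\<xi> \<in> sphere 0 1" "\<And>\<eta>. \<eta> \<in> sphere 0 1 \<Longrightarrow> p \<xi> \<le> p \<eta>"
    using continuous_attains_inf[OF compact_sphere] by metis
  show thesis
  proof (rule that)
    show "p \<xi> > 0" using pos[OF \<xi>(1)] p by (metis ennreal_0 less_eq_real_def)
    show "ennreal (p \<xi>) \<le> Psi \<Omega> u \<eta>" if "\<eta> \<in> sphere 0 1" for \<eta>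
      using \<xi>(2)[OF that] by (simp add: p ennreal_leI)
  qed
qed

section \<open>Surface measure of the sphere and of small caps\<close>

lemma ennreal_inverse_antimono:
  fixes a b :: ennreal
  assumes "a \<le> b"
  shows "inverse b \<le> inverse a"
proof (cases "a = 0 \<or> b = top")
  case False
  with assms obtain r s where "a = ennreal r" "b = ennreal s" "0 < r" "0 \<le> s"
    by (cases a; cases b) (auto simp: less_le top_unique)
  moreover from this assms have "r \<le> s" by simp
  ultimately show ?thesis by (simp add: inverse_ennreal ennreal_leI le_imp_inverse_le)
qed auto

lemma space_sphere_measure [simp]: "space (sphere_measure :: (real^'n) measure) = sphere 0 1"
  by (simp add: sphere_measure_def space_scale_measure space_restrict_space)

lemma sets_sphere_measure:
  "sets (sphere_measure :: (real^'n) measure) = sets (restrict_space borel (sphere 0 1))"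
  by (simp add: sphere_measure_def)

lemma emeasure_sphere_measure_space:
  "emeasure sphere_measure (sphere 0 1 :: (real^'n) set)
    = ennreal (real CARD('n) * unit_ball_vol (real CARD('n)))"
proof -
  have "{r *\<^sub>R \<xi> | r \<xi>. 0 < r \<and> r \<le> 1 \<and> \<xi> \<in> sphere (0::real^'n) 1} = cball 0 1 - {0}"
  proof (intro equalityI subsetI)
    fix x :: "real^'n" assume "x \<in> cball 0 1 - {0}"
    then have "x = norm x *\<^sub>R (x /\<^sub>R norm x)" "0 < norm x" "norm x \<le> 1" "x /\<^sub>R norm x \<in> sphere 0 1"
      by auto
    then show "x \<in> {r *\<^sub>R \<xi> | r \<xi>. 0 < r \<and> r \<le> 1 \<and> \<xi> \<in> sphere (0::real^'n) 1}" by blast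
  qed auto
  then have "emeasure sphere_measure (sphere 0 1 :: (real^'n) set)
      = of_nat CARD('n) * emeasure lborel (cball (0::real^'n) 1 - {0})"
    using emeasure_sphere_measure[of "sphere (0::real^'n) 1"] by simp
  also have "emeasure lborel (cball (0::real^'n) 1 - {0}) = emeasure lborel (cball (0::real^'n) 1)"
    by (rule emeasure_Diff_null_set) auto
  also have "\<dots> = ennreal (unit_ball_vol (real CARD('n)))"
    by (subst emeasure_cball) auto
  finally show ?thesis
    by (simp add: ennreal_of_nat_eq_real_of_nat ennreal_mult')
qed

text \<open>A cap of radius \<open>1/m\<close> has surface measure of order at least \<open>m\<^bsup>-(n-1)\<^esup>\<close>, because the cone
  over it contains \<open>m\<close> disjoint balls of radius \<open>1/(8m)\<close>, whose centres are strung along the axis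
  between distances \<open>1/2\<close> and \<open>3/4\<close> from the vertex.\<close>

lemma emeasure_sphere_cap_ge:
  fixes \<xi> :: "real^'n"
  assumes \<xi>: "norm \<xi> = 1" and m: "m > 0"
  shows "emeasure sphere_measure (sphere 0 1 \<inter> cball \<xi> (1 / real m))
    \<ge> ennreal (real m * (unit_ball_vol (real CARD('n)) * (1 / (8 * real m)) ^ CARD('n)))"
proof -
  define \<rho> where "\<rho> = 1 / (8 * real m)"
  define a where "a k = 1/2 + 2 * real k * \<rho>" for k :: nat
  define B where "B k = ball (a k *\<^sub>R \<xi>) \<rho>" for k
  let ?C = "sphere 0 1 \<inter> cball \<xi> (1 / real m)"
  \<comment> \<open>Neighbouring centres are \<open>2\<rho>\<close> apart, so the open balls are just disjoint. On each ball
    \<open>norm x \<ge> 3/8\<close> and \<open>x\<close> is within \<open>2\<rho>\<close> of \<open>norm x *\<^sub>R \<xi>\<close>, so that its direction is within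
    \<open>2\<rho> / (3/8) \<le> 8\<rho> = 1/m\<close> of \<open>\<xi>\<close>.\<close>
  have \<rho>: "0 < \<rho>" "\<rho> \<le> 1/8" "8 * \<rho> = 1 / real m" "8 * real m * \<rho> = 1"
    using m by (auto simp: \<rho>_def field_simps)
  have a: "1/2 \<le> a k" "a k \<le> 3/4" if "k < m" for k
  proof -
    show "1/2 \<le> a k" using \<rho>(1) by (simp add: a_def)
    have "real k * \<rho> \<le> real m * \<rho>" using that \<rho> by (intro mult_right_mono) auto
    then show "a k \<le> 3/4" using \<rho>(4) by (simp add: a_def)
  qed
  have sub: "B k \<subseteq> {r *\<^sub>R \<eta> | r \<eta>. 0 < r \<and> r \<le> 1 \<and> \<eta> \<in> ?C}" if k: "k < m" for k
  proof
    fix x assume "x \<in> B k"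
    then have x: "norm (x - a k *\<^sub>R \<xi>) < \<rho>" by (simp add: B_def dist_norm norm_minus_commute)
    have na: "norm (a k *\<^sub>R \<xi>) = a k" using a[OF k] \<xi> by simp
    have d: "\<bar>norm x - a k\<bar> < \<rho>"
      using norm_triangle_ineq3[of x "a k *\<^sub>R \<xi>"] x unfolding na by simp
    with a[OF k] \<rho>(2) have nx: "3/8 \<le> norm x" "norm x \<le> 1" by linarith+
    then have x0: "x \<noteq> 0" by auto
    have split: "x - norm x *\<^sub>R \<xi> = (x - a k *\<^sub>R \<xi>) + (a k - norm x) *\<^sub>R \<xi>"
      by (simp add: algebra_simps)
    have "norm (x - norm x *\<^sub>R \<xi>) \<le> norm (x - a k *\<^sub>R \<xi>) + norm ((a k - norm x) *\<^sub>R \<xi>)"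
      unfolding split by (rule norm_triangle_ineq)
    also have "\<dots> = norm (x - a k *\<^sub>R \<xi>) + \<bar>a k - norm x\<bar>"
      using \<xi> by simp
    also have "\<dots> \<le> 2 * \<rho>" using x d by linarith
    also have "\<dots> \<le> norm x * (8 * \<rho>)"
      using mult_right_mono[OF nx(1), of "8 * \<rho>"] \<rho>(1) by simp
    finally have "norm (x - norm x *\<^sub>R \<xi>) \<le> norm x * (8 * \<rho>)" .
    moreover have "norm x * norm (x /\<^sub>R norm x - \<xi>) = norm (norm x *\<^sub>R (x /\<^sub>R norm x - \<xi>))"
      by simp
    moreover have "norm x *\<^sub>R (x /\<^sub>R norm x - \<xi>) = x - norm x *\<^sub>R \<xi>"
      using x0 by (simp add: scaleR_right_diff_distrib)
    ultimately have "norm x * norm (x /\<^sub>R norm x - \<xi>) \<le> norm x * (8 * \<rho>)" by metis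
    then have "norm (x /\<^sub>R norm x - \<xi>) \<le> 1 / real m"
      using x0 \<rho>(3) by (metis mult_le_cancel_left_pos zero_less_norm_iff)
    then have "x /\<^sub>R norm x \<in> ?C" using x0 by (simp add: dist_norm norm_minus_commute)
    moreover have "x = norm x *\<^sub>R (x /\<^sub>R norm x)" "0 < norm x" using x0 by auto
    ultimately show "x \<in> {r *\<^sub>R \<eta> | r \<eta>. 0 < r \<and> r \<le> 1 \<and> \<eta> \<in> ?C}" using nx(2) by blast
  qed
  have disj: "disjoint_family_on B {..<m}"
    unfolding disjoint_family_on_def
  proof (intro ballI impI)
    fix k l :: nat assume "k \<noteq> l"
    then have "1 \<le> \<bar>real k - real l\<bar>" by linarith
    then have "2 * \<rho> \<le> \<bar>real k - real l\<bar> * (2 * \<rho>)"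
      using mult_right_mono[of 1 "\<bar>real k - real l\<bar>" "2 * \<rho>"] \<rho>(1) by simp
    also have "\<dots> = \<bar>a k - a l\<bar>"
    proof -
      have "a k - a l = (real k - real l) * (2 * \<rho>)" by (simp add: a_def algebra_simps)
      then show ?thesis using \<rho>(1) by (simp add: abs_mult)
    qed
    also have "\<dots> = dist (a k *\<^sub>R \<xi>) (a l *\<^sub>R \<xi>)"
      using \<xi> by (simp add: dist_norm flip: scaleR_left_diff_distrib)
    finally show "B k \<inter> B l = {}"
      unfolding B_def by (intro disjoint_ballI) simp
  qed
  have "ennreal (real m * (unit_ball_vol (real CARD('n)) * \<rho> ^ CARD('n)))
      = (\<Sum>k<m. emeasure lborel (B k))"
    using \<rho>(1) by (simp add: B_def emeasure_ball ennreal_of_nat_eq_real_of_nat ennreal_mult')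
  also have "\<dots> = emeasure lborel (\<Union>k<m. B k)"
    by (rule sum_emeasure[OF _ disj]) (auto simp: B_def)
  also have "\<dots> \<le> emeasure sphere_measure ?C"
  proof -
    let ?K = "{r *\<^sub>R \<eta> | r \<eta>. 0 < r \<and> r \<le> 1 \<and> \<eta> \<in> ?C}"
    have "?K = (\<lambda>x. x /\<^sub>R norm x) -` ?C \<inter> (cball 0 1 - {0})"
    proof (intro equalityI subsetI)
      fix x assume "x \<in> (\<lambda>x. x /\<^sub>R norm x) -` ?C \<inter> (cball 0 1 - {0})"
      then have "x = norm x *\<^sub>R (x /\<^sub>R norm x)" "0 < norm x" "norm x \<le> 1" "x /\<^sub>R norm x \<in> ?C"
        by auto
      then show "x \<in> ?K" by blast
    qed auto
    also have "\<dots> \<in> sets lborel"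
    proof -
      have "(\<lambda>x::real^'n. x /\<^sub>R norm x) -` ?C \<inter> space borel \<in> sets borel"
        by (rule measurable_sets[where A = borel]) (measurable, auto)
      then show ?thesis by auto
    qed
    finally have K: "?K \<in> sets lborel" .
    have "emeasure lborel (\<Union>k<m. B k) \<le> emeasure lborel ?K"
      using sub by (intro emeasure_mono K) blast
    also have "\<dots> \<le> of_nat CARD('n) * emeasure lborel ?K"
      using mult_right_mono[of 1 "of_nat CARD('n) :: ennreal" "emeasure lborel ?K"]
      by (simp add: Suc_le_eq)
    also have "\<dots> = emeasure sphere_measure ?C"
      by (rule emeasure_sphere_measure[symmetric]) auto
    finally show ?thesis .
  qed
  finally show ?thesis by (simp add: \<rho>_def)
qed

text \<open>The sphere has dimension \<open>n - 1\<close>, so \<open>|\<eta> - \<xi>|\<^bsup>-n\<^esup>\<close> is not integrable near \<open>\<xi>\<close>: on the cap of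
  radius \<open>1/m\<close> the integrand is at least of order \<open>m\<^bsup>n\<^esup>\<close>, hence the integral at least of order
  \<open>m\<close>.\<close>

lemma nn_integral_sphere_inverse_power_eq_infinity:
  fixes \<xi> :: "real^'n" and f :: "real^'n \<Rightarrow> ennreal"
  assumes \<xi>: "norm \<xi> = 1" and L: "L > 0"
    and f: "\<And>\<eta>. \<eta> \<in> sphere 0 1 \<Longrightarrow> f \<eta> \<le> ennreal (L * norm (\<eta> - \<xi>))"
  shows "(\<integral>\<^sup>+\<eta>. inverse (f \<eta> ^ CARD('n)) \<partial>sphere_measure) = \<infinity>"
proof -
  let ?n = "CARD('n)"
  let ?I = "\<integral>\<^sup>+\<eta>. inverse (f \<eta> ^ ?n) \<partial>sphere_measure"
  \<comment> \<open>the lower bound for the cap times the lower bound \<open>(m/L)^n\<close> for the integrand on it is \<open>K * m\<close>\<close>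
  define K where "K = unit_ball_vol (real ?n) / (8 * L) ^ ?n"
  have K: "K > 0" using L by (simp add: K_def)
  have lower: "ennreal (real m * K) \<le> ?I" if m: "m > 0" for m :: nat
  proof -
    let ?C = "sphere 0 1 \<inter> cball \<xi> (1 / real m)"
    have "real m * K = (real m / L) ^ ?n * (real m * (unit_ball_vol (real ?n) * (1 / (8 * real m)) ^ ?n))"
      using m L by (simp add: K_def power_divide power_mult_distrib field_simps)
    then have "ennreal (real m * K) = ennreal ((real m / L) ^ ?n)
        * ennreal (real m * (unit_ball_vol (real ?n) * (1 / (8 * real m)) ^ ?n))"
      using L by (simp only:) (rule ennreal_mult', simp)
    also have "\<dots> \<le> ennreal ((real m / L) ^ ?n) * emeasure sphere_measure ?C"
      by (intro mult_left_mono emeasure_sphere_cap_ge \<xi> m) auto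
    also have "\<dots> = (\<integral>\<^sup>+\<eta>. ennreal ((real m / L) ^ ?n) * indicator ?C \<eta> \<partial>sphere_measure)"
    proof (rule nn_integral_cmult_indicator[symmetric])
      show "?C \<in> sets sphere_measure"
        unfolding sets_sphere_measure by (subst sets_restrict_space_iff) auto
    qed
    also have "\<dots> \<le> ?I"
    proof (rule nn_integral_mono)
      fix \<eta> :: "real^'n" assume "\<eta> \<in> space sphere_measure"
      then have \<eta>: "\<eta> \<in> sphere 0 1" by simp
      show "ennreal ((real m / L) ^ ?n) * indicator ?C \<eta> \<le> inverse (f \<eta> ^ ?n)"
      proof (cases "\<eta> \<in> ?C")
        case True
        then have "norm (\<eta> - \<xi>) \<le> 1 / real m" by (simp add: dist_norm norm_minus_commute)
        then have "L * norm (\<eta> - \<xi>) \<le> L / real m" using mult_left_mono[of _ _ L] L by fastforce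
        then have "f \<eta> \<le> ennreal (L / real m)" using f[OF \<eta>] by (meson ennreal_leI order_trans)
        then have "f \<eta> ^ ?n \<le> ennreal ((L / real m) ^ ?n)"
          using L by (subst ennreal_power[symmetric]) (auto intro: power_mono)
        then have "inverse (ennreal ((L / real m) ^ ?n)) \<le> inverse (f \<eta> ^ ?n)"
          by (rule ennreal_inverse_antimono)
        moreover have "inverse (ennreal ((L / real m) ^ ?n)) = ennreal ((real m / L) ^ ?n)"
          using L m by (subst inverse_ennreal) (auto simp: power_divide)
        ultimately show ?thesis using True by simp
      qed simp
    qed
    finally show ?thesis .
  qed
  show ?thesis
  proof (rule ccontr)
    assume "?I \<noteq> \<infinity>"
    then obtain r where r: "?I = ennreal r" "0 \<le> r" by (cases ?I) auto
    obtain m :: nat where m: "r / K < real m" using reals_Archimedean2 by blast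
    then have "m > 0" using r K by (metis divide_nonneg_pos gr0I not_less of_nat_0)
    from lower[OF this] r have "real m * K \<le> r" by simp
    with m K show False by (simp add: field_simps)
  qed
qed

section \<open>Vanishing of the affine energy\<close>

theorem theorem3p1:
  fixes \<Omega> :: "(real^'n) set" and u :: "real^'n \<Rightarrow> real"
  assumes "CARD('n) \<ge> 2" and "open \<Omega>" and "u \<in> BV \<Omega>"
  shows "affine_energy \<Omega> u = 0 \<longleftrightarrow> (\<exists>\<xi> \<in> sphere 0 1. Psi \<Omega> u \<xi> = 0)"
proof -
  let ?n = "CARD('n)" and ?S = "sphere 0 1 :: (real^'n) set"
  let ?I = "\<integral>\<^sup>+\<xi>. inverse (Psi \<Omega> u \<xi> ^ ?n) \<partial>sphere_measure"
  obtain L where L: "L > 0" "\<And>\<xi> \<eta>. Psi \<Omega> u \<xi> \<le> Psi \<Omega> u \<eta> + ennreal (L * norm (\<xi> - \<eta>))"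
    using Psi_lipschitz[OF assms(3)] by metis
  define S where "S = real ?n * unit_ball_vol (real ?n)"
  have S: "S > 0" "emeasure sphere_measure ?S = ennreal S"
    unfolding S_def using emeasure_sphere_measure_space by simp_all
  have const: "(\<integral>\<^sup>+\<xi>. inverse (ennreal c ^ ?n) \<partial>(sphere_measure :: (real^'n) measure))
      = ennreal (inverse (c ^ ?n) * S)" if "c > 0" for c
    using that S by (simp add: ennreal_power inverse_ennreal ennreal_mult')
  have antimono: "inverse (b ^ ?n) \<le> inverse (a ^ ?n)" if "a \<le> b" for a b :: ennreal
    using that by (intro ennreal_inverse_antimono power_mono) auto
  show ?thesis
  proof
    assume "\<exists>\<xi>\<in>?S. Psi \<Omega> u \<xi> = 0"
    then obtain \<xi> where \<xi>: "norm \<xi> = 1" "Psi \<Omega> u \<xi> = 0" by auto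
    then have "?I = \<infinity>"
      using L(2)[of _ \<xi>] by (intro nn_integral_sphere_inverse_power_eq_infinity[OF _ L(1)]) auto
    then show "affine_energy \<Omega> u = 0" by (simp add: affine_energy_def)
  next
    assume zero: "affine_energy \<Omega> u = 0"
    show "\<exists>\<xi>\<in>?S. Psi \<Omega> u \<xi> = 0"
    proof (rule ccontr)
      assume "\<not> (\<exists>\<xi>\<in>?S. Psi \<Omega> u \<xi> = 0)"
      then obtain c where c: "c > 0" "\<And>\<xi>. \<xi> \<in> ?S \<Longrightarrow> ennreal c \<le> Psi \<Omega> u \<xi>"
        using Psi_bounded_below[OF assms(3)] by metis
      have "?I \<le> (\<integral>\<^sup>+\<xi>. inverse (ennreal c ^ ?n) \<partial>(sphere_measure :: (real^'n) measure))"
        using c(2) by (intro nn_integral_mono antimono) simp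
      then have "?I \<le> ennreal (inverse (c ^ ?n) * S)" unfolding const[OF c(1)] .
      then have fin: "?I < \<infinity>"
        using le_less_trans ennreal_less_top unfolding infinity_ennreal_def by blast
      \<comment> \<open>a zero integral would also make the energy zero, as \<open>0 powr a = 0\<close>; it is excluded by the
        upper bound \<open>L\<close> for \<open>Psi\<close> on the sphere\<close>
      have "(\<integral>\<^sup>+\<xi>. inverse (ennreal L ^ ?n) \<partial>(sphere_measure :: (real^'n) measure)) \<le> ?I"
      proof (intro nn_integral_mono antimono)
        fix \<xi> :: "real^'n" assume "\<xi> \<in> space sphere_measure"
        then show "Psi \<Omega> u \<xi> \<le> ennreal L" using L(2)[of \<xi> 0] by (simp add: Psi_zero)
      qed
      then have "ennreal (inverse (L ^ ?n) * S) \<le> ?I" unfolding const[OF L(1)] .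
      moreover have "0 < ennreal (inverse (L ^ ?n) * S)" using L S by simp
      ultimately have "0 < ?I" by (rule less_le_trans[rotated])
      with fin have "0 < enn2real ?I" by (simp add: enn2real_positive_iff)
      moreover have "alpha ?n > 0"
      proof -
        have "unit_ball_vol (real ?n - 1) > 0" using assms(1) by (intro unit_ball_vol_pos) simp
        moreover have "real ?n * unit_ball_vol (real ?n) > 0" by simp
        ultimately show ?thesis
          unfolding alpha_def by (intro mult_pos_pos) (simp_all only: powr_gt_zero, simp_all)
      qed
      ultimately have "affine_energy \<Omega> u > 0" using fin by (simp add: affine_energy_def Let_def)
      with zero show False by simp
    qed
  qed
qed

end
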